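(* Let $n\ge 1$, let $\mathbf{p}=(p_1,\dots,p_n)$ with $p_i>0$ for all $i$ and $\sum_{i=1}^n p_i=1$, and let $f_0(x)=\sum_{i=1}^n p_i\delta_{\xi_i}(x)$ be a discrete density with $n$ atoms $\xi_1,\dots,\xi_n$. Let $\mathbf{w}=(w_1,\dots,w_n)$ be a random vector such that $n\mathbf{w}\sim\mathrm{Mult}(n,\mathbf{p})$, and let $f(x)=\sum_{i=1}^n w_i\delta_{\xi_i}(x)$. Then the expected value of the Kullback-Leibler divergence $\mathrm{KL}(f\,||\,f_0)=\sum_{i=1}^n w_i\log\left(\frac{w_i}{p_i}\right)$ satisfies $$\mathrm{E}\{\mathrm{KL}(f\,||\,f_0)\}\le\sum_{i=1}^n p_i\log\left(p_i+\frac{1-p_i}{n}\right)-H(\mathbf{p}),$$ where $H(\mathbf{p})=\sum_{i=1}^n p_i\log p_i$. In the special case $p_i=1/n$ for all $i$, $\mathrm{E}\{\mathrm{KL}(f\,||\,f_0)\}\le\log(2-1/n)\le\log 2$.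
   Context: $\mathrm{Mult}(n,\mathbf{p})$ is the multinomial distribution with $n$ trials and $n$ categories with probabilities $p_1,\dots,p_n$. The convention $0\log 0=0$ is used. Note the sign convention $H(\mathbf{p})=\sum_i p_i\log p_i$ (no minus sign). *)

theory Defs
  imports "HOL-Probability.Probability"
begin

definition multinomial_mass :: "nat \<Rightarrow> real ^ 'n \<Rightarrow> nat ^ 'n \<Rightarrow> real" where
  "multinomial_mass N p k =
     (if (\<Sum>i\<in>UNIV. k $ i) = N
      then fact N / (\<Prod>i\<in>UNIV. fact (k $ i)) * (\<Prod>i\<in>UNIV. p $ i ^ (k $ i)) else 0)"

definition multinomial_pmf :: "nat \<Rightarrow> real ^ 'n \<Rightarrow> (nat ^ 'n) pmf" where
  "multinomial_pmf N p = embed_pmf (multinomial_mass N p)"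

text \<open>
  The definition through \<^const>\<open>embed_pmf\<close> is only meaningful if the mass function sums to one.
  This is shown by identifying it with the category counts of \<open>N\<close> independent trials.
\<close>

primrec trial_counts_pmf :: "nat \<Rightarrow> real ^ 'n \<Rightarrow> (nat ^ 'n) pmf" where
  "trial_counts_pmf 0 p = return_pmf 0"
| "trial_counts_pmf (Suc N) p =
     bind_pmf (embed_pmf (\<lambda>i. p $ i)) (\<lambda>i. map_pmf (\<lambda>k. k + axis i 1) (trial_counts_pmf N p))"

lemma pmf_categorical:
  fixes p :: "real ^ 'n"
  assumes "\<And>i. 0 \<le> p $ i" and "(\<Sum>i\<in>UNIV. p $ i) = 1"
  shows "pmf (embed_pmf (\<lambda>i. p $ i)) i = p $ i"
proof (rule pmf_embed_pmf)
  show "(\<integral>\<^sup>+ x. ennreal (p $ x) \<partial>count_space UNIV) = 1"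
    using assms by (simp add: nn_integral_count_space_finite sum_ennreal)
qed (use assms in auto)

lemma multinomial_mass_step:
  fixes p :: "real ^ 'n" and k :: "nat ^ 'n"
  shows "p $ i * multinomial_mass N p k =
         multinomial_mass (Suc N) p (k + axis i 1) * real (Suc (k $ i)) / real (Suc N)"
proof -
  define k' where "k' = k + axis i 1"
  have ki: "k' $ i = Suc (k $ i)" and kj: "\<And>j. j \<noteq> i \<Longrightarrow> k' $ j = k $ j"
    by (auto simp: k'_def axis_def)
  have s: "(\<Sum>j\<in>UNIV. k' $ j) = Suc (\<Sum>j\<in>UNIV. k $ j)"
    by (simp add: sum.remove[of UNIV i] ki kj)
  have f: "(\<Prod>j\<in>UNIV. fact (k' $ j)) = real (Suc (k $ i)) * (\<Prod>j\<in>UNIV. fact (k $ j))"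
    by (simp add: prod.remove[of UNIV i] ki kj algebra_simps)
  have q: "(\<Prod>j\<in>UNIV. p $ j ^ (k' $ j)) = p $ i * (\<Prod>j\<in>UNIV. p $ j ^ (k $ j))"
    by (simp add: prod.remove[of UNIV i] ki kj)
  have nz: "(\<Prod>j\<in>UNIV. fact (k $ j) :: real) \<noteq> 0" by simp
  show ?thesis
    unfolding k'_def[symmetric] multinomial_mass_def s f q
    using nz by (simp add: divide_simps del: of_nat_Suc)
qed

lemma pmf_trial_counts:
  fixes p :: "real ^ 'n"
  assumes p: "\<And>i. 0 \<le> p $ i" "(\<Sum>i\<in>UNIV. p $ i) = 1"
  shows "pmf (trial_counts_pmf N p) k = multinomial_mass N p k"
proof (induction N arbitrary: k)
  case 0
  show ?case
    by (auto simp: multinomial_mass_def indicator_def vec_eq_iff)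
next
  case (Suc N)
  have shift: "p $ i * pmf (map_pmf (\<lambda>k. k + axis i 1) (trial_counts_pmf N p)) k
        = multinomial_mass (Suc N) p k * real (k $ i) / real (Suc N)" for i
  proof (cases "k $ i")
    case 0
    then have "k \<notin> (\<lambda>k. k + axis i 1) ` set_pmf (trial_counts_pmf N p)"
      by (auto simp: axis_def)
    then show ?thesis
      by (simp add: pmf_map_outside 0)
  next
    case (Suc m)
    define k' where "k' = (\<chi> j. if j = i then m else k $ j)"
    have k: "k = k' + axis i 1" and m: "k' $ i = m"
      using Suc by (auto simp: k'_def vec_eq_iff axis_def)
    have inj: "inj (\<lambda>k :: nat ^ 'n. k + axis i 1)"
      by (auto simp: inj_on_def)
    have "pmf (map_pmf (\<lambda>k. k + axis i 1) (trial_counts_pmf N p)) k = multinomial_mass N p k'"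
      unfolding k using pmf_map_inj'[OF inj, of "trial_counts_pmf N p" k'] Suc.IH by simp
    then show ?thesis
      using multinomial_mass_step[of p i N k', folded k] by (simp only: m Suc)
  qed
  have "pmf (trial_counts_pmf (Suc N) p) k
      = (\<Sum>i\<in>UNIV. p $ i * pmf (map_pmf (\<lambda>k. k + axis i 1) (trial_counts_pmf N p)) k)"
    by (simp add: pmf_bind integral_measure_pmf[of UNIV] pmf_categorical[OF p])
  also have "\<dots> = multinomial_mass (Suc N) p k * real (\<Sum>i\<in>UNIV. k $ i) / real (Suc N)"
    by (simp only: shift of_nat_sum sum_distrib_left sum_divide_distrib)
  also have "\<dots> = multinomial_mass (Suc N) p k"
    by (simp add: multinomial_mass_def del: of_nat_Suc of_nat_sum)
  finally show ?case .
qed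

lemma multinomial_pmf_eq_trial_counts:
  fixes p :: "real ^ 'n"
  assumes "\<And>i. 0 \<le> p $ i" and "(\<Sum>i\<in>UNIV. p $ i) = 1"
  shows "multinomial_pmf N p = trial_counts_pmf N p"
proof -
  have "multinomial_mass N p = pmf (trial_counts_pmf N p)"
    using pmf_trial_counts[OF assms] by auto
  then show ?thesis
    unfolding multinomial_pmf_def
    by (intro pmf_eqI) (simp add: pmf_embed_pmf nn_integral_pmf_eq_1)
qed

lemma pmf_multinomial:
  fixes p :: "real ^ 'n"
  assumes "\<And>i. 0 \<le> p $ i" and "(\<Sum>i\<in>UNIV. p $ i) = 1"
  shows "pmf (multinomial_pmf N p) k = multinomial_mass N p k"
  by (simp add: multinomial_pmf_eq_trial_counts pmf_trial_counts assms)

definition atomic_density :: "('n::finite \<Rightarrow> 'b) \<Rightarrow> real ^ 'n \<Rightarrow> 'b \<Rightarrow> real" where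
  "atomic_density \<xi> v x = (\<Sum>i\<in>UNIV. v $ i * indicator {\<xi> i} x)"

text \<open>
  Natural logarithm; \<^const>\<open>KL_divergence\<close> takes the reference measure first, so the arguments
  are swapped.
\<close>

definition KL :: "('b \<Rightarrow> real) \<Rightarrow> ('b \<Rightarrow> real) \<Rightarrow> real" where
  "KL f g = KL_divergence (exp 1) (density (count_space UNIV) g) (density (count_space UNIV) f)"

text \<open>
  No minus sign, so this is the negative of the Shannon entropy.  The convention
  \<open>0 log 0 = 0\<close> holds because of the factor \<open>0\<close>.
\<close>

definition H :: "real ^ 'n \<Rightarrow> real" where
  "H p = (\<Sum>i\<in>UNIV. p $ i * ln (p $ i))"

end

theory Submission
  imports Defs
begin

text \<open>
  Everything rests on the tangent inequality \<open>x ln x \<le> x ln a + x\<^sup>2 / a - x\<close>. Taking expectations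
  with \<open>x = w\<^sub>i\<close> and \<open>a = E(w\<^sub>i\<^sup>2) / E(w\<^sub>i) = p\<^sub>i + (1 - p\<^sub>i) / n\<close>, the last two terms cancel;
  summing over \<open>i\<close> gives the bound. This is Jensen's inequality for the logarithm under the
  size-biased law of \<open>w\<^sub>i\<close>.
\<close>

text \<open>This is \<open>ln t \<le> t - 1\<close> at \<open>t = x / a\<close>, multiplied by
  \<open>x\<close>. The term in \<open>ln p\<close> merely rewrites it for a summand of the
  divergence.\<close>

lemma x_ln_x_le_tangent:
  fixes a p x :: real
  assumes "0 \<le> x" "0 < a" "0 < p"
  shows "x * ln (x / p) \<le> x * (ln a - ln p) + x\<^sup>2 / a - x"
proof (cases "x = 0")
  case False
  then have x: "0 < x" using assms by simp
  have "ln (x / a) \<le> x / a - 1"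
    using x assms by (intro ln_le_minus_one) simp
  then have "x * ln (x / a) \<le> x * (x / a - 1)"
    using x by simp
  then show ?thesis
    using x assms by (simp add: ln_div algebra_simps power2_eq_square)
qed simp

section \<open>Moments of the multinomial distribution\<close>

lemma finite_set_trial_counts: "finite (set_pmf (trial_counts_pmf N p))"
  by (induction N) simp_all

text \<open>Conditioning on the category \<open>j\<close> of one trial. This yields recursions in
  \<open>N\<close> for the moments, avoiding sums of multinomial coefficients.\<close>

lemma expectation_trial_counts_Suc:
  fixes p :: "real ^ 'n" and h :: "nat ^ 'n \<Rightarrow> real"
  assumes "\<And>i. 0 \<le> p $ i" and "(\<Sum>i\<in>UNIV. p $ i) = 1"
  shows "measure_pmf.expectation (trial_counts_pmf (Suc N) p) h =
    (\<Sum>j\<in>UNIV. p $ j * measure_pmf.expectation (trial_counts_pmf N p) (\<lambda>k. h (k + axis j 1)))"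
  by (simp add: pmf_expectation_bind[where A = UNIV] finite_set_trial_counts pmf_categorical assms)

lemma weighted_sum_add_if:
  fixes p :: "real ^ 'n"
  assumes "(\<Sum>i\<in>UNIV. p $ i) = 1"
  shows "(\<Sum>j\<in>UNIV. p $ j * (c + (if j = i then d else 0))) = c + p $ i * d"
proof -
  have "(\<Sum>j\<in>UNIV. p $ j * (c + (if j = i then d else 0))) =
      (\<Sum>j\<in>UNIV. p $ j) * c + (\<Sum>j\<in>UNIV. if j = i then p $ j * d else 0)"
    unfolding sum_distrib_right sum.distrib[symmetric]
    by (intro sum.cong) (auto simp: algebra_simps)
  then show ?thesis using assms by simp
qed

lemma expectation_trial_counts:
  fixes p :: "real ^ 'n"
  assumes p: "\<And>i. 0 \<le> p $ i" "(\<Sum>i\<in>UNIV. p $ i) = 1"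
  shows "measure_pmf.expectation (trial_counts_pmf N p) (\<lambda>k. real (k $ i)) = N * p $ i"
proof (induction N)
  case (Suc N)
  have [simp]: "integrable (trial_counts_pmf N p) g" for g :: "_ \<Rightarrow> real"
    by (intro integrable_measure_pmf_finite finite_set_trial_counts)
  have "measure_pmf.expectation (trial_counts_pmf (Suc N) p) (\<lambda>k. real (k $ i)) =
      (\<Sum>j\<in>UNIV. p $ j * (N * p $ i + (if j = i then 1 else 0)))"
    unfolding expectation_trial_counts_Suc[OF p] using Suc.IH
    by (intro sum.cong) (auto simp: axis_def)
  also have "\<dots> = Suc N * p $ i"
    by (subst weighted_sum_add_if) (simp_all add: p algebra_simps)
  finally show ?case .
qed simp

text \<open>A trial in category \<open>i\<close> raises the square of its count by
  \<open>2 * k $ i + 1\<close>, any other trial leaves it unchanged; so the recursion is driven by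
  the mean. The closed form is the squared mean plus the binomial variance.\<close>

lemma expectation_trial_counts_square:
  fixes p :: "real ^ 'n"
  assumes p: "\<And>i. 0 \<le> p $ i" "(\<Sum>i\<in>UNIV. p $ i) = 1"
  shows "measure_pmf.expectation (trial_counts_pmf N p) (\<lambda>k. (real (k $ i))\<^sup>2) =
    N * p $ i * (N * p $ i + (1 - p $ i))"
proof (induction N)
  case (Suc N)
  define s where "s = N * p $ i * (N * p $ i + (1 - p $ i))"
  have [simp]: "integrable (trial_counts_pmf N p) g" for g :: "_ \<Rightarrow> real"
    by (intro integrable_measure_pmf_finite finite_set_trial_counts)
  have "measure_pmf.expectation (trial_counts_pmf (Suc N) p) (\<lambda>k. (real (k $ i))\<^sup>2) =
      (\<Sum>j\<in>UNIV. p $ j * (s + (if j = i then 2 * (N * p $ i) + 1 else 0)))"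
    unfolding expectation_trial_counts_Suc[OF p]
  proof (intro sum.cong arg_cong2[where f = "(*)"] refl)
    fix j
    have "real ((k + axis j 1) $ i) ^ 2 =
        real (k $ i) ^ 2 + (if j = i then 2 * real (k $ i) + 1 else 0)" for k :: "nat ^ 'n"
      by (auto simp: axis_def power2_eq_square algebra_simps)
    then show "measure_pmf.expectation (trial_counts_pmf N p) (\<lambda>k. (real ((k + axis j 1) $ i))\<^sup>2) =
        s + (if j = i then 2 * (N * p $ i) + 1 else 0)"
      using Suc.IH expectation_trial_counts[OF p] by (simp add: s_def)
  qed
  also have "\<dots> = s + p $ i * (2 * (N * p $ i) + 1)"
    by (rule weighted_sum_add_if) (rule p)
  also have "\<dots> = Suc N * p $ i * (Suc N * p $ i + (1 - p $ i))"
    by (simp add: s_def algebra_simps)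
  finally show ?case .
qed simp

section \<open>Divergence of finitely supported densities\<close>

lemma atomic_density_atom:
  assumes "inj \<xi>"
  shows "atomic_density \<xi> v (\<xi> i) = v $ i"
  using assms by (simp add: atomic_density_def indicator_def inj_eq)

lemma atomic_density_outside:
  assumes "x \<notin> range \<xi>"
  shows "atomic_density \<xi> v x = 0"
  using assms by (auto simp: atomic_density_def indicator_def intro!: sum.neutral)

lemma integral_count_space_atoms:
  fixes g :: "'b \<Rightarrow> real" and \<xi> :: "'n::finite \<Rightarrow> 'b"
  assumes "inj \<xi>" "\<And>x. x \<notin> range \<xi> \<Longrightarrow> g x = 0"
  shows "integral\<^sup>L (count_space UNIV) g = (\<Sum>i\<in>UNIV. g (\<xi> i))"
proof -
  have sub: "{x. g x \<noteq> 0} \<subseteq> range \<xi>" using assms(2) by auto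
  then have "finite {x. g x \<noteq> 0}" by (rule finite_subset) simp
  then have "integral\<^sup>L (count_space UNIV) g = sum g {x. g x \<noteq> 0}"
    by (simp add: lebesgue_integral_count_space_finite_support)
  also have "\<dots> = sum g (range \<xi>)"
    using sub by (intro sum.mono_neutral_left) auto
  also have "\<dots> = (\<Sum>i\<in>UNIV. g (\<xi> i))"
    using assms(1) by (simp add: sum.reindex)
  finally show ?thesis .
qed

text \<open>
  Densities are coerced to \<^typ>\<open>ennreal\<close>, which truncates negative weights to \<open>0\<close>. Stating the
  formula for arbitrary weights makes the divergence a measurable function of \<open>v\<close> everywhere.
\<close>

lemma KL_atomic_density:
  fixes \<xi> :: "'n::finite \<Rightarrow> 'b"
  assumes p: "\<And>i. 0 < p $ i" and \<xi>: "inj \<xi>"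
  shows "KL (atomic_density \<xi> v) (atomic_density \<xi> p) =
    (\<Sum>i\<in>UNIV. max 0 (v $ i) * ln (max 0 (v $ i) / p $ i))"
proof -
  let ?f = "atomic_density \<xi> v" and ?g = "atomic_density \<xi> p"
  let ?C = "count_space (UNIV :: 'b set)"
  \<comment> \<open>The Radon-Nikodym derivative of the first measure with respect to the second.
    The truncation agrees with \<open>ennreal\<close>, and off the atoms
    \<open>0 / 0 = 0\<close>.\<close>
  define r where "r x = max 0 (?f x) / ?g x" for x
  have g: "0 \<le> ?g x" for x
    unfolding atomic_density_def
    by (intro sum_nonneg mult_nonneg_nonneg less_imp_le[OF p]) simp
  have r: "0 \<le> r x" for x
    by (simp add: r_def g)
  have eq: "ennreal (?g x) * ennreal (r x) = ennreal (?f x)" for x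
  proof (cases "x \<in> range \<xi>")
    case True
    then obtain i where "x = \<xi> i" by auto
    then have "?g x * r x = max 0 (?f x)"
      using p[of i] by (simp add: r_def atomic_density_atom \<xi>)
    then show ?thesis
      using g r by (metis ennreal_mult max.commute ennreal_max_0)
  qed (simp add: atomic_density_outside)
  \<comment> \<open>As \<open>'b\<close> may be uncountable, counting measure need not be
    sigma-finite. The measure with density \<open>?g\<close> is finite, so it can serve as the base
    measure in \<open>KL_density\<close>.\<close>
  have "emeasure (density ?C ?g) UNIV = (\<integral>\<^sup>+x. ennreal (?g x) \<partial>?C)"
    by (simp add: emeasure_density)
  also have "\<dots> = (\<Sum>x\<in>range \<xi>. ennreal (?g x))"
    by (intro nn_integral_count_space') (auto simp: atomic_density_outside)
  also have "\<dots> < \<infinity>"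
    by (simp add: sum_ennreal g)
  finally have "finite_measure (density ?C ?g)"
    by (intro finite_measureI) simp
  then interpret D: finite_measure "density ?C ?g" .
  have "density ?C ?f = density (density ?C ?g) r"
    by (simp add: density_density_eq eq)
  then have "KL ?f ?g = KL_divergence (exp 1) (density ?C ?g) (density (density ?C ?g) r)"
    by (simp add: KL_def)
  also have "\<dots> = (\<integral>x. r x * log (exp 1) (r x) \<partial>density ?C ?g)"
    by (rule D.KL_density) (auto simp: r)
  also have "\<dots> = (\<integral>x. ?g x * (r x * ln (r x)) \<partial>?C)"
    by (simp add: integral_real_density g log_def)
  also have "\<dots> = (\<Sum>i\<in>UNIV. ?g (\<xi> i) * (r (\<xi> i) * ln (r (\<xi> i))))"
    by (intro integral_count_space_atoms \<xi>) (simp add: atomic_density_outside)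
  also have "\<dots> = (\<Sum>i\<in>UNIV. max 0 (v $ i) * ln (max 0 (v $ i) / p $ i))"
  proof (intro sum.cong refl)
    fix i
    show "?g (\<xi> i) * (r (\<xi> i) * ln (r (\<xi> i))) = max 0 (v $ i) * ln (max 0 (v $ i) / p $ i)"
      using p[of i] by (simp add: r_def atomic_density_atom \<xi>)
  qed
  finally show ?thesis .
qed

section \<open>The expected divergence\<close>

lemma expectation_count_ln_le:
  fixes p :: "real ^ 'n"
  assumes p: "\<And>i. 0 < p $ i" "(\<Sum>i\<in>UNIV. p $ i) = 1" and N: "0 < N"
  defines "a \<equiv> \<lambda>i. p $ i + (1 - p $ i) / real N"
  shows "measure_pmf.expectation (trial_counts_pmf N p)
      (\<lambda>k. real (k $ i) / N * ln (real (k $ i) / N / p $ i)) \<le> p $ i * ln (a i) - p $ i * ln (p $ i)"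
proof -
  let ?E = "measure_pmf.expectation (trial_counts_pmf N p)"
  have p0: "\<And>i. 0 \<le> p $ i" using p by (simp add: less_imp_le)
  have "p $ i \<le> 1"
    using member_le_sum[of i UNIV "\<lambda>i. p $ i"] p p0 by simp
  then have a: "0 < a i"
    using p(1)[of i] by (simp add: a_def add_pos_nonneg)
  have [simp]: "integrable (trial_counts_pmf N p) g" for g :: "_ \<Rightarrow> real"
    by (intro integrable_measure_pmf_finite finite_set_trial_counts)
  have "?E (\<lambda>k. real (k $ i) / N * ln (real (k $ i) / N / p $ i))
      \<le> ?E (\<lambda>k. real (k $ i) / N * (ln (a i) - ln (p $ i)) + (real (k $ i) / N)\<^sup>2 / a i - real (k $ i) / N)"
    using a p by (intro integral_mono x_ln_x_le_tangent) auto
  also have "\<dots> = p $ i * (ln (a i) - ln (p $ i)) +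
      N * p $ i * (N * p $ i + (1 - p $ i)) / (real N)\<^sup>2 / a i - p $ i"
    using N by (simp add: power_divide expectation_trial_counts[OF p0 p(2)]
        expectation_trial_counts_square[OF p0 p(2)])
  \<comment> \<open>The second moment of \<open>k $ i / N\<close> is \<open>p $ i * a i\<close>;
    dividing by \<open>a i\<close> leaves \<open>p $ i\<close>, which cancels the last term.\<close>
  also have "N * p $ i * (N * p $ i + (1 - p $ i)) / (real N)\<^sup>2 = p $ i * a i"
    using N by (simp add: a_def field_simps power2_eq_square)
  finally show ?thesis
    using a by (simp add: algebra_simps)
qed

theorem proposition4:
  fixes p :: "real ^ 'n" and \<xi> :: "'n \<Rightarrow> 'b"
    and M :: "'a measure" and w :: "'a \<Rightarrow> real ^ 'n"
  assumes p_pos: "\<And>i. 0 < p $ i"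
    and p_sum: "(\<Sum>i\<in>UNIV. p $ i) = 1"
    and atoms: "inj \<xi>"
    and M: "prob_space M"
    and w: "w \<in> borel_measurable M"
    and nw: "distr M borel (\<lambda>\<omega>. real CARD('n) *\<^sub>R w \<omega>) =
             distr (multinomial_pmf CARD('n) p) borel (\<lambda>k. \<chi> i. real (k $ i))"
  shows "let n = real CARD('n);
             f\<^sub>0 = atomic_density \<xi> p;
             f = (\<lambda>\<omega>. atomic_density \<xi> (w \<omega>))
         in (AE \<omega> in M. KL (f \<omega>) f\<^sub>0 = (\<Sum>i\<in>UNIV. w \<omega> $ i * ln (w \<omega> $ i / p $ i))) \<and>
            integrable M (\<lambda>\<omega>. KL (f \<omega>) f\<^sub>0) \<and>
            (LINT \<omega>|M. KL (f \<omega>) f\<^sub>0)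
              \<le> (\<Sum>i\<in>UNIV. p $ i * ln (p $ i + (1 - p $ i) / n)) - H p \<and>
            ((\<forall>i. p $ i = 1 / n) \<longrightarrow>
               (LINT \<omega>|M. KL (f \<omega>) f\<^sub>0) \<le> ln (2 - 1 / n) \<and> ln (2 - 1 / n) \<le> ln 2)"
proof -
  let ?n = "real CARD('n)"
  let ?Q = "trial_counts_pmf CARD('n) p"
  let ?K = "\<lambda>\<omega>. KL (atomic_density \<xi> (w \<omega>)) (atomic_density \<xi> p)"
  let ?W = "\<lambda>\<omega>. ?n *\<^sub>R w \<omega>"
  let ?R = "\<lambda>k :: nat ^ 'n. \<chi> i. real (k $ i)"
  let ?B = "(\<Sum>i\<in>UNIV. p $ i * ln (p $ i + (1 - p $ i) / ?n)) - H p"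
  \<comment> \<open>The divergence as a function of the scaled weights, since the hypothesis fixes
    only the law of \<open>?W\<close>. With the truncation,
    \<open>?K \<omega> = G (?W \<omega>)\<close> holds at every point, not just almost
    everywhere.\<close>
  define G where
    "G x = (\<Sum>i\<in>UNIV. max 0 (x $ i / ?n) * ln (max 0 (x $ i / ?n) / p $ i))" for x :: "real ^ 'n"
  note p0 = less_imp_le[OF p_pos]
  have G [measurable]: "G \<in> borel_measurable borel"
    unfolding G_def by measurable
  have W [measurable]: "?W \<in> borel_measurable M"
    using w by simp
  have R [measurable]: "?R \<in> borel_measurable ?Q"
    by simp
  have law: "distr M borel ?W = distr ?Q borel ?R"
    using nw by (simp add: multinomial_pmf_eq_trial_counts p0 p_sum)
  have K: "?K \<omega> = G (?W \<omega>)" for \<omega>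
    by (simp add: KL_atomic_density p_pos atoms G_def)
  have [simp]: "integrable ?Q g" for g :: "_ \<Rightarrow> real"
    by (intro integrable_measure_pmf_finite finite_set_trial_counts)

  \<comment> \<open>Counts are nonnegative, and equality of laws carries this over to
    \<open>w\<close> almost surely, where the truncation then disappears.\<close>
  have "AE x in distr ?Q borel ?R. \<forall>i. 0 \<le> x $ i"
    by (subst AE_distr_iff) auto
  then have "AE \<omega> in M. \<forall>i. 0 \<le> ?W \<omega> $ i"
    unfolding law[symmetric] by (subst (asm) AE_distr_iff) auto
  then have AE: "AE \<omega> in M. ?K \<omega> = (\<Sum>i\<in>UNIV. w \<omega> $ i * ln (w \<omega> $ i / p $ i))"
    by eventually_elim (simp add: KL_atomic_density p_pos atoms zero_le_mult_iff max_def)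

  \<comment> \<open>The common law is the image of a finitely supported one, so any measurable
    function is integrable.\<close>
  have "integrable (distr M borel ?W) G"
    unfolding law by (subst integrable_distr_eq) auto
  then have int: "integrable M ?K"
    unfolding K by (subst (asm) integrable_distr_eq) auto

  have "(LINT \<omega>|M. ?K \<omega>) = integral\<^sup>L (distr M borel ?W) G"
    unfolding K by (subst integral_distr) auto
  also have "\<dots> = measure_pmf.expectation ?Q (\<lambda>k. G (?R k))"
    unfolding law by (subst integral_distr) auto
  also have "\<dots> = (\<Sum>i\<in>UNIV. measure_pmf.expectation ?Q
      (\<lambda>k. real (k $ i) / ?n * ln (real (k $ i) / ?n / p $ i)))"
    by (simp add: G_def max_def)
  also have "\<dots> \<le> (\<Sum>i\<in>UNIV. p $ i * ln (p $ i + (1 - p $ i) / ?n) - p $ i * ln (p $ i))"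
    by (intro sum_mono expectation_count_ln_le p_pos p_sum) simp
  also have "\<dots> = ?B"
    by (simp add: H_def sum_subtractf)
  finally have bound: "(LINT \<omega>|M. ?K \<omega>) \<le> ?B" .

  have n: "1 \<le> ?n"
    by (simp add: Suc_le_eq)
  then have "1 / ?n \<le> 1"
    by simp
  then have pos: "0 < 2 - 1 / ?n"
    by linarith
  \<comment> \<open>Under uniform weights both sums average a constant, leaving a difference of two
    logarithms.\<close>
  have "?B = ln (2 - 1 / ?n)" if u: "\<forall>i. p $ i = 1 / ?n"
  proof -
    have "1 / ?n + (1 - 1 / ?n) / ?n = (2 - 1 / ?n) / ?n"
      using n by (simp add: field_simps)
    then have "?B = ln ((2 - 1 / ?n) / ?n) - ln (1 / ?n)"
      using u by (simp add: H_def)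
    also have "\<dots> = ln (2 - 1 / ?n)"
      using pos n by (simp add: ln_div)
    finally show ?thesis .
  qed
  moreover have "ln (2 - 1 / ?n) \<le> ln 2"
    using pos by simp
  ultimately show ?thesis
    using AE int bound unfolding Let_def by auto
qed

end
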